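(* Let $A$ be an admissible set of addition chains and let $r\ge0$ be real. Then $\mathscr{D}^A\cap[0,r]$ is a well-ordered subset of $\mathbb{R}$ with order type at least $\omega^{\lfloor r\rfloor}$ and at most \[\omega^{q^A(r)-1}q^A(r)+\cdots+\omega^2\cdot3+\omega\cdot2+1,\] which is less than $\omega^{q^A(r)-1}(q^A(r)+1)$ and hence less than $\omega^{q^A(r)}$. The same holds for $\mathscr{D}^A_{st}\cap[0,r]$.
   Context: An addition chain for a positive integer $n$ is a sequence $(a_0,\ldots,a_r)$ with $a_0=1$, $a_r=n$, and for every $1\le k\le r$ there exist $0\le i,j<k$ with $a_k=a_i+a_j$; $r$ is its length. For a set $A$ of addition chains, $\ell^A(n)$ is the least length of an addition chain for $n$ belonging to $A$. $\nu_2(n)$ is the number of $1$'s in the binary expansion of $n$. $A$ is admissible if (i) for every $n\ge1$, $\ell^A(n)$ is defined and $\ell^A(n)\le\lfloor\log_2 n\rfloor+\nu_2(n)-1$, and (ii) for every $n\ge1$, $\ell^A(2n)\le\ell^A(n)+1$. The $A$-defect is $\delta^A(n)=\ell^A(n)-\log_2 n$, and $\mathscr{D}^A=\{\delta^A(n):n\ge1\}$. A positive integer $m$ is $A$-stable if $\ell^A(2^k m)=\ell^A(m)+k$ for all $k\ge0$; $\mathscr{D}^A_{st}$ is the set of $\delta^A(m)$ with $m$ $A$-stable. For real $r\ge0$, $q^A(r)=\max\{\nu_2(n): \delta^A(n)\le r\}$ (this maximum is finite). *)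

theory Defs
  imports Complex_Main "HOL-Library.Nat_Bijection"
begin

unbundle cardinal_syntax

definition addition_chain :: "nat list \<Rightarrow> bool" where
  "addition_chain a \<longleftrightarrow>
     a \<noteq> [] \<and> a ! 0 = 1 \<and>
     (\<forall>k. 1 \<le> k \<and> k < length a \<longrightarrow> (\<exists>i<k. \<exists>j<k. a ! k = a ! i + a ! j))"

definition addition_chain_for :: "nat list \<Rightarrow> nat \<Rightarrow> bool" where
  "addition_chain_for a n \<longleftrightarrow> addition_chain a \<and> last a = n"

text \<open>The list \<open>[a\<^sub>0, \<dots>, a\<^sub>r]\<close> has \<open>r + 1\<close> entries and represents a chain of length \<open>r\<close>.
  The least element below is meaningful only if \<open>A\<close> contains a chain for \<open>n\<close>.\<close>

definition chain_len :: "nat list set \<Rightarrow> nat \<Rightarrow> nat" where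
  "chain_len A n = (LEAST r. \<exists>a\<in>A. addition_chain_for a n \<and> r = length a - 1)"

definition nu2 :: "nat \<Rightarrow> nat" where
  "nu2 n = card {k. bit n k}"

definition admissible :: "nat list set \<Rightarrow> bool" where
  "admissible A \<longleftrightarrow>
     (\<forall>a\<in>A. addition_chain a) \<and>
     (\<forall>n\<ge>1. (\<exists>a\<in>A. addition_chain_for a n) \<and>
             int (chain_len A n) \<le> \<lfloor>log 2 (real n)\<rfloor> + int (nu2 n) - 1) \<and>
     (\<forall>n\<ge>1. chain_len A (2 * n) \<le> chain_len A n + 1)"

definition defect :: "nat list set \<Rightarrow> nat \<Rightarrow> real" where
  "defect A n = real (chain_len A n) - log 2 (real n)"

definition defects :: "nat list set \<Rightarrow> real set" where
  "defects A = {defect A n | n. n \<ge> 1}"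

definition stable :: "nat list set \<Rightarrow> nat \<Rightarrow> bool" where
  "stable A m \<longleftrightarrow> m \<ge> 1 \<and> (\<forall>k. chain_len A (2 ^ k * m) = chain_len A m + k)"

definition stable_defects :: "nat list set \<Rightarrow> real set" where
  "stable_defects A = {defect A m | m. stable A m}"

definition qmax :: "nat list set \<Rightarrow> real \<Rightarrow> nat" where
  "qmax A r = Max {nu2 n | n. n \<ge> 1 \<and> defect A n \<le> r}"

definition real_order_on :: "real set \<Rightarrow> real rel" where
  "real_order_on S = {(x, y). x \<in> S \<and> y \<in> S \<and> x \<le> y}"

text \<open>Ordinals are represented, up to \<open>=o\<close>, by reflexive well-orders on sets of natural numbers.
  All ordinals below \<open>\<omega>\<^sup>\<omega>\<close> are countable, so one carrier type suffices and powers can be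
  defined by recursion. Here \<open>natLeq\<close> represents \<open>\<omega>\<close> and \<open>natLeq_on n\<close> represents \<open>n\<close>.\<close>

definition ord_add :: "nat rel \<Rightarrow> nat rel \<Rightarrow> nat rel" where
  "ord_add r s =
     {(sum_encode (Inl x), sum_encode (Inl x')) | x x'. (x, x') \<in> r} \<union>
     {(sum_encode (Inr y), sum_encode (Inr y')) | y y'. (y, y') \<in> s} \<union>
     {(sum_encode (Inl x), sum_encode (Inr y)) | x y. x \<in> Field r \<and> y \<in> Field s}"

text \<open>The usual ordinal product \<open>r \<cdot> s\<close>, that is, \<open>s\<close> many copies of \<open>r\<close>: the second
  component is the more significant one.\<close>

definition ord_mult :: "nat rel \<Rightarrow> nat rel \<Rightarrow> nat rel" where
  "ord_mult r s =
     {(prod_encode (x, y), prod_encode (x', y')) | x y x' y'.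
        x \<in> Field r \<and> x' \<in> Field r \<and> y \<in> Field s \<and> y' \<in> Field s \<and>
        (y \<noteq> y' \<and> (y, y') \<in> s \<or> y = y' \<and> (x, x') \<in> r)}"

primrec omega_pow :: "nat \<Rightarrow> nat rel" where
  "omega_pow 0 = natLeq_on 1"
| "omega_pow (Suc k) = ord_mult (omega_pow k) natLeq"

text \<open>\<open>omega_sum q\<close> represents
  \<open>\<omega>\<^bsup>q-1\<^esup>\<cdot>q + \<dots> + \<omega>\<^sup>2\<cdot>3 + \<omega>\<cdot>2 + 1\<close>, with the empty sum \<open>0\<close> for \<open>q = 0\<close>.\<close>

primrec omega_sum :: "nat \<Rightarrow> nat rel" where
  "omega_sum 0 = natLeq_on 0"
| "omega_sum (Suc k) = ord_add (ord_mult (omega_pow k) (natLeq_on (k + 1))) (omega_sum k)"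

end

theory Submission
  imports Defs "HOL-Library.Infinite_Set"
begin

text \<open>Write \<open>n = 2\<^sup>t + v\<close> with \<open>v < 2\<^sup>t\<close>. For an admissible set of chains the least length is
  \<open>t + s\<close> with \<open>0 \<le> s \<le> nu2 n - 1\<close>, so the defect is \<open>s - log 2 (1 + v / 2\<^sup>t)\<close>.
  Upper bound: for \<open>nu2 n \<le> q\<close> the possible fractions \<open>v / 2\<^sup>t \<noteq> 0\<close>, ordered decreasingly, have
  order type at most \<open>\<omega>\<^bsup>q-1\<^esup>\<close> (compare the positions of the binary digits lexicographically), and
  \<open>s\<close> takes at most \<open>q\<close> values, which even bounds the order type by \<open>\<omega>\<^bsup>q-1\<^esup> \<cdot> q\<close>.
  Lower bound: the fractions with exactly \<open>k\<close> binary digits one have order type \<open>\<omega>\<^sup>k\<close>; multiplying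
  by a power of two makes each number stable with some \<open>s \<le> k\<close>, and by indecomposability of
  \<open>\<omega>\<^sup>k\<close> a single value of \<open>s\<close> already occurs on a set of full order type.
  Finiteness of \<open>qmax A r\<close>: each step of a chain that is not a doubling costs a fixed amount of
  defect, and \<open>nu2 n \<le> 2\<^sup>f\<close> if there are \<open>f\<close> such steps.\<close>

section \<open>Strict embeddings of well-orders\<close>

text \<open>The image need not be an initial segment, so explicit maps are easy to verify; between
  well-orders such a map exists exactly when \<open>r \<le>o s\<close>. Well-foundedness is not
  built in, so \<open>r\<close> may be an order that is yet to be shown well-founded.\<close>

definition strict_emb :: "'a rel \<Rightarrow> 'b rel \<Rightarrow> ('a \<Rightarrow> 'b) \<Rightarrow> bool" where
  "strict_emb r s f \<longleftrightarrow> (\<forall>x\<in>Field r. f x \<in> Field s) \<and>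
     (\<forall>x y. (x, y) \<in> r \<and> x \<noteq> y \<longrightarrow> (f x, f y) \<in> s \<and> f x \<noteq> f y)"

lemma strict_embI:
  assumes "\<And>x. x \<in> Field r \<Longrightarrow> f x \<in> Field s"
    and "\<And>x y. (x, y) \<in> r \<Longrightarrow> x \<noteq> y \<Longrightarrow> (f x, f y) \<in> s \<and> f x \<noteq> f y"
  shows "strict_emb r s f"
  using assms unfolding strict_emb_def by blast

lemma strict_emb_id: "strict_emb r r id"
  by (simp add: strict_emb_def)

lemma strict_emb_comp:
  "strict_emb r s f \<Longrightarrow> strict_emb s t g \<Longrightarrow> strict_emb r t (g \<circ> f)"
  unfolding strict_emb_def by simp

text \<open>A descent propagates: if \<open>h a\<close> lies below \<open>a\<close>, then
  \<open>h (h a)\<close> lies below \<open>h a\<close>, which contradicts well-foundedness.\<close>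

lemma strict_emb_no_descent:
  assumes r: "Well_order r" and h: "strict_emb r r h" and a: "(h a, a) \<in> r" "h a \<noteq> a"
  shows False
proof -
  have "wf (r - Id)" using r by (simp add: well_order_on_def)
  then show False using a
  proof (induction a rule: wf_induct_rule)
    case (less a)
    then show ?case using h unfolding strict_emb_def by blast
  qed
qed

lemma embed_imp_strict_emb:
  assumes r: "Well_order r" and s: "Well_order s" and g: "embed r s g"
  shows "strict_emb r s g"
proof (rule strict_embI)
  show "g x \<in> Field s" if "x \<in> Field r" for x
    using embed_Field[OF g] that by blast
  have c: "compat r s g" and i: "inj_on g (Field r)"
    using embed_compat[OF g] embed_inj_on[OF r g] by auto
  show "(g x, g y) \<in> s \<and> g x \<noteq> g y" if "(x, y) \<in> r" "x \<noteq> y" for x y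
    using c i that unfolding compat_def by (meson FieldI1 FieldI2 inj_onD)
qed

lemma ordLeq_obtain_strict_emb:
  assumes "r \<le>o s" obtains g where "strict_emb r s g"
  using assms embed_imp_strict_emb unfolding ordLeq_def by blast

text \<open>If \<open>s\<close> could be mapped back into \<open>r\<close> by some \<open>g\<close>,
  the self-map \<open>f \<circ> g\<close> of \<open>s\<close> would send \<open>u\<close> strictly
  below itself.\<close>

lemma strict_emb_bounded_ordLess:
  assumes r: "Well_order r" and s: "Well_order s" and f: "strict_emb r s f"
    and u: "\<And>x. x \<in> Field r \<Longrightarrow> (f x, u) \<in> s \<and> f x \<noteq> u" "u \<in> Field s"
  shows "r <o s"
proof (rule ccontr)
  assume "\<not> r <o s"
  then have "s \<le>o r" using r s not_ordLess_iff_ordLeq by blast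
  then obtain g where g: "strict_emb s r g" by (rule ordLeq_obtain_strict_emb)
  have "g u \<in> Field r" using g u(2) unfolding strict_emb_def by blast
  then show False
    using strict_emb_no_descent[OF s strict_emb_comp[OF g f], of u] u(1) by auto
qed

text \<open>Otherwise \<open>s\<close> is isomorphic to the part of \<open>r\<close> below some
  \<open>a\<close>, and going from \<open>r\<close> through \<open>s\<close> into that part sends
  \<open>a\<close> strictly below itself.\<close>

lemma strict_emb_ordLeq:
  assumes r: "Well_order r" and s: "Well_order s" and f: "strict_emb r s f"
  shows "r \<le>o s"
proof (rule ccontr)
  assume "\<not> r \<le>o s"
  then have "s <o r" using r s not_ordLeq_iff_ordLess by blast
  then obtain a g where a: "a \<in> Field r" and g: "embed s (Restr r (underS r a)) g"
    unfolding ordLess_iff_ordIso_Restr[OF r s] ordIso_def iso_def by blast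
  let ?t = "Restr r (underS r a)"
  have t: "Well_order ?t" using r by (rule Well_order_Restr)
  have g': "strict_emb s ?t g" by (rule embed_imp_strict_emb[OF s t g])
  have Ft: "Field ?t \<subseteq> underS r a" by (auto simp: Field_def)
  have "strict_emb ?t r id"
    unfolding strict_emb_def by (auto simp: Field_def)
  then have h: "strict_emb r r (id \<circ> (g \<circ> f))"
    using strict_emb_comp strict_emb_comp[OF f g'] by blast
  have "g (f a) \<in> underS r a"
    using a f g' Ft unfolding strict_emb_def by blast
  then show False using strict_emb_no_descent[OF r h, of a] by (auto simp: underS_def)
qed

section \<open>Orders on sets of reals\<close>

lemma Field_real_order_on [simp]: "Field (real_order_on S) = S"
  by (auto simp: real_order_on_def Field_def)

text \<open>Linearity comes from the reals and well-foundedness is pulled back along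
  \<open>f\<close>; thus the map that gives the upper bound also shows that the defects are
  well-ordered.\<close>

lemma well_order_on_real_order_on:
  assumes s: "Well_order s" and f: "strict_emb (real_order_on S) s f"
  shows "well_order_on S (real_order_on S)"
proof -
  have "wf (inv_image (s - Id) f)" using s by (simp add: well_order_on_def)
  moreover have "real_order_on S - Id \<subseteq> inv_image (s - Id) f"
  proof (intro subrelI)
    fix x y assume "(x, y) \<in> real_order_on S - Id"
    then show "(x, y) \<in> inv_image (s - Id) f" using f unfolding strict_emb_def by simp
  qed
  ultimately have "wf (real_order_on S - Id)" by (rule wf_subset)
  moreover have "linear_order_on S (real_order_on S)"
    unfolding linear_order_on_def partial_order_on_def preorder_on_def
    by (auto simp: real_order_on_def refl_on_def trans_def antisym_def total_on_def)
  ultimately show ?thesis by (simp add: well_order_on_def)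
qed

section \<open>Ordinal sums and products\<close>

lemma Field_ord_mult:
  assumes r: "Well_order r" and s: "Well_order s"
  shows "Field (ord_mult r s) = prod_encode ` (Field r \<times> Field s)"
proof -
  have *: "(x, x) \<in> r" if "x \<in> Field r" for x
    using r that by (simp add: order_on_defs refl_on_def)
  show ?thesis
  proof
    show "Field (ord_mult r s) \<subseteq> prod_encode ` (Field r \<times> Field s)"
      unfolding Field_def ord_mult_def by auto
    show "prod_encode ` (Field r \<times> Field s) \<subseteq> Field (ord_mult r s)"
    proof clarify
      fix x y assume "x \<in> Field r" "y \<in> Field s"
      then have "(prod_encode (x, y), prod_encode (x, y)) \<in> ord_mult r s"
        using * unfolding ord_mult_def by blast
      then show "prod_encode (x, y) \<in> Field (ord_mult r s)" by (rule FieldI1)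
    qed
  qed
qed

lemma ord_mult_iff:
  "(prod_encode (x, y), prod_encode (x', y')) \<in> ord_mult r s \<longleftrightarrow>
     x \<in> Field r \<and> x' \<in> Field r \<and> y \<in> Field s \<and> y' \<in> Field s \<and>
        (y \<noteq> y' \<and> (y, y') \<in> s \<or> y = y' \<and> (x, x') \<in> r)"
  unfolding ord_mult_def by auto

lemma ord_mult_cases:
  assumes "(p, p') \<in> ord_mult r s"
  obtains x y x' y' where "p = prod_encode (x, y)" "p' = prod_encode (x', y')"
    "x \<in> Field r" "x' \<in> Field r" "y \<in> Field s" "y' \<in> Field s"
    "y \<noteq> y' \<and> (y, y') \<in> s \<or> y = y' \<and> (x, x') \<in> r"
  using assms unfolding ord_mult_def by auto

lemma Well_order_ord_mult:
  assumes r: "Well_order r" and s: "Well_order s"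
  shows "Well_order (ord_mult r s)"
proof -
  let ?m = "ord_mult r s"
  have rr: "\<And>x. x \<in> Field r \<Longrightarrow> (x, x) \<in> r"
    and rt: "trans r" and ra: "antisym r" and rtot: "total_on (Field r) r" and rw: "wf (r - Id)"
    using r by (auto simp: order_on_defs refl_on_def)
  have st: "trans s" and sa: "antisym s" and stot: "total_on (Field s) s" and sw: "wf (s - Id)"
    using s by (auto simp: order_on_defs refl_on_def)
  have sub: "?m \<subseteq> Field ?m \<times> Field ?m" by (auto simp: Field_def)
  have "refl_on (Field ?m) ?m"
    unfolding refl_on_def by (auto simp: Field_ord_mult[OF r s] ord_mult_iff rr)
  moreover have "trans ?m"
  proof (rule transI)
    fix p p' p'' assume 1: "(p, p') \<in> ?m" and 2: "(p', p'') \<in> ?m"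
    from 1 obtain x y x' y' where p: "p = prod_encode (x, y)" "p' = prod_encode (x', y')"
      by (rule ord_mult_cases)
    from 2 obtain x'' y'' where p'': "p'' = prod_encode (x'', y'')"
      by (metis ord_mult_cases)
    show "(p, p'') \<in> ?m"
      using 1 2 unfolding p p'' ord_mult_iff
      using rt st sa by (auto dest: transD antisymD)
  qed
  moreover have "antisym ?m"
  proof (rule antisymI)
    fix p p' assume 1: "(p, p') \<in> ?m" and 2: "(p', p) \<in> ?m"
    from 1 obtain x y x' y' where p: "p = prod_encode (x, y)" "p' = prod_encode (x', y')"
      by (rule ord_mult_cases)
    show "p = p'"
      using 1 2 unfolding p ord_mult_iff using ra sa by (auto dest: antisymD)
  qed
  moreover have "total_on (Field ?m) ?m"
    unfolding total_on_def Field_ord_mult[OF r s]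
    using rtot stot unfolding total_on_def by (auto simp: ord_mult_iff)
  moreover have "wf (?m - Id)"
  proof (rule wf_subset)
    \<comment> \<open>\<open>prod.swap\<close> brings the more significant second component to the
      front of the lexicographic order.\<close>
    show "wf (inv_image ((s - Id) <*lex*> (r - Id)) (prod.swap \<circ> prod_decode))"
      using rw sw by (intro wf_inv_image wf_lex_prod)
    show "?m - Id \<subseteq> inv_image ((s - Id) <*lex*> (r - Id)) (prod.swap \<circ> prod_decode)"
      by (auto elim!: ord_mult_cases)
  qed
  ultimately show ?thesis
    using sub unfolding order_on_defs by (intro conjI)
qed

lemma ord_add_iff:
  "(sum_encode (Inl x), sum_encode (Inl x')) \<in> ord_add r s \<longleftrightarrow> (x, x') \<in> r"
  "(sum_encode (Inr y), sum_encode (Inr y')) \<in> ord_add r s \<longleftrightarrow> (y, y') \<in> s"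
  "(sum_encode (Inl x), sum_encode (Inr y)) \<in> ord_add r s \<longleftrightarrow> x \<in> Field r \<and> y \<in> Field s"
  "(sum_encode (Inr y), sum_encode (Inl x)) \<notin> ord_add r s"
  unfolding ord_add_def using inj_sum_encode by (auto simp: inj_eq)

lemma Field_ord_add:
  "Field (ord_add r s) = sum_encode ` (Inl ` Field r \<union> Inr ` Field s)"
proof (intro subset_antisym subsetI)
  fix p assume "p \<in> Field (ord_add r s)"
  then obtain p' where "(p, p') \<in> ord_add r s \<or> (p', p) \<in> ord_add r s"
    by (auto simp: Field_def)
  then show "p \<in> sum_encode ` (Inl ` Field r \<union> Inr ` Field s)"
    unfolding ord_add_def by (auto simp: inj_image_mem_iff[OF inj_sum_encode] dest: FieldI1 FieldI2)
next
  fix p assume "p \<in> sum_encode ` (Inl ` Field r \<union> Inr ` Field s)"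
  then consider x where "p = sum_encode (Inl x)" "x \<in> Field r"
    | y where "p = sum_encode (Inr y)" "y \<in> Field s" by blast
  then show "p \<in> Field (ord_add r s)"
  proof cases
    case 1
    then show ?thesis by (auto simp: Field_def[of r] intro: FieldI1 FieldI2 ord_add_iff(1)[THEN iffD2])
  next
    case 2
    then show ?thesis by (auto simp: Field_def[of s] intro: FieldI1 FieldI2 ord_add_iff(2)[THEN iffD2])
  qed
qed

lemma Well_order_ord_add:
  assumes r: "Well_order r" and s: "Well_order s"
  shows "Well_order (ord_add r s)"
proof -
  let ?m = "ord_add r s"
  have rr: "\<And>x. x \<in> Field r \<Longrightarrow> (x, x) \<in> r"
    and rt: "trans r" and ra: "antisym r" and rtot: "total_on (Field r) r" and rw: "wf (r - Id)"
    using r by (auto simp: order_on_defs refl_on_def)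
  have sr: "\<And>x. x \<in> Field s \<Longrightarrow> (x, x) \<in> s"
    and st: "trans s" and sa: "antisym s" and stot: "total_on (Field s) s" and sw: "wf (s - Id)"
    using s by (auto simp: order_on_defs refl_on_def)
  have sub: "?m \<subseteq> Field ?m \<times> Field ?m" by (auto simp: Field_def)
  have ex: "\<exists>z. p = sum_encode z" for p by (metis sum_decode_inverse)
  have "refl_on (Field ?m) ?m"
    unfolding refl_on_def by (auto simp: Field_ord_add ord_add_iff rr sr)
  moreover have "trans ?m"
  proof (rule transI)
    fix p p' p'' assume 1: "(p, p') \<in> ?m" and 2: "(p', p'') \<in> ?m"
    obtain z z' z'' where z: "p = sum_encode z" "p' = sum_encode z'" "p'' = sum_encode z''"
      using ex by metis
    show "(p, p'') \<in> ?m"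
      using 1 2 rt st unfolding z
      by (cases z; cases z'; cases z'') (auto simp: ord_add_iff Field_def dest: transD)
  qed
  moreover have "antisym ?m"
  proof (rule antisymI)
    fix p p' assume 1: "(p, p') \<in> ?m" and 2: "(p', p) \<in> ?m"
    obtain z z' where z: "p = sum_encode z" "p' = sum_encode z'" using ex by metis
    show "p = p'"
      using 1 2 ra sa unfolding z
      by (cases z; cases z') (auto simp: ord_add_iff dest: antisymD)
  qed
  moreover have "total_on (Field ?m) ?m"
    unfolding total_on_def Field_ord_add
  proof (intro ballI impI)
    fix p p' assume pp: "p \<in> sum_encode ` (Inl ` Field r \<union> Inr ` Field s)"
      "p' \<in> sum_encode ` (Inl ` Field r \<union> Inr ` Field s)" "p \<noteq> p'"
    then obtain z z' where z: "p = sum_encode z" "p' = sum_encode z'" by blast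
    show "(p, p') \<in> ?m \<or> (p', p) \<in> ?m"
    proof (cases z)
      case (Inl x)
      show ?thesis
      proof (cases z')
        case (Inl x')
        with pp z \<open>z = Inl x\<close> have "x \<in> Field r" "x' \<in> Field r" "x \<noteq> x'"
          by (auto simp: inj_eq[OF inj_sum_encode])
        then show ?thesis
          using rtot z \<open>z = Inl x\<close> Inl by (simp add: ord_add_iff total_on_def)
      next
        case (Inr y')
        with pp z \<open>z = Inl x\<close> show ?thesis by (auto simp: ord_add_iff inj_eq[OF inj_sum_encode])
      qed
    next
      case (Inr y)
      show ?thesis
      proof (cases z')
        case (Inl x')
        with pp z \<open>z = Inr y\<close> show ?thesis by (auto simp: ord_add_iff inj_eq[OF inj_sum_encode])
      next
        case (Inr y')
        with pp z \<open>z = Inr y\<close> have "y \<in> Field s" "y' \<in> Field s" "y \<noteq> y'"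
          by (auto simp: inj_eq[OF inj_sum_encode])
        then show ?thesis
          using stot z \<open>z = Inr y\<close> Inr by (simp add: ord_add_iff total_on_def)
      qed
    qed
  qed
  moreover have "wf (?m - Id)"
  proof (rule wf_subset)
    \<comment> \<open>The leading tag puts the left summand below the right one; the other zeros are
      dummies for the component of the absent summand.\<close>
    show "wf (inv_image (inv_image (less_than <*lex*> ((r - Id) <*lex*> (s - Id)))
        (case_sum (\<lambda>x. (0, x, 0)) (\<lambda>y. (1, 0, y)))) sum_decode)"
      using rw sw by (intro wf_inv_image wf_lex_prod) auto
    show "?m - Id \<subseteq> inv_image (inv_image (less_than <*lex*> ((r - Id) <*lex*> (s - Id)))
        (case_sum (\<lambda>x. (0, x, 0)) (\<lambda>y. (1, 0, y)))) sum_decode"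
      unfolding ord_add_def by auto
  qed
  ultimately show ?thesis
    using sub unfolding order_on_defs by (intro conjI)
qed

section \<open>Powers of omega and the bounding sum\<close>

lemma Well_order_omega_pow: "Well_order (omega_pow k)"
proof (induction k)
  case 0
  show ?case unfolding omega_pow.simps by (rule natLeq_on_Well_order)
next
  case (Suc k)
  then show ?case by (simp add: Well_order_ord_mult natLeq_Well_order)
qed

lemma Well_order_omega_sum: "Well_order (omega_sum k)"
proof (induction k)
  case 0
  show ?case unfolding omega_sum.simps by (rule natLeq_on_Well_order)
next
  case (Suc k)
  then show ?case unfolding omega_sum.simps
    by (intro Well_order_ord_add Well_order_ord_mult natLeq_on_Well_order Well_order_omega_pow)
qed

lemma Field_omega_pow_0: "Field (omega_pow 0) = {0}"
  by (auto simp: Field_def)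

text \<open>Induction step for two targets at once: \<open>natLeq\<close> turns the product into
  \<open>\<omega>^(k+1)\<close>, \<open>natLeq_on (k + 2)\<close> into
  \<open>\<omega>^k (k+2)\<close>. Either one has a copy of \<open>\<omega>^k\<close> with index
  \<open>k + 1\<close>, which houses the tail \<open>omega_sum k\<close> and, above it, the
  bound.\<close>

lemma strict_emb_omega_sum_bounded:
  assumes f: "strict_emb (omega_sum k) (omega_pow k) f"
    and u: "u \<in> Field (omega_pow k)"
      "\<And>x. x \<in> Field (omega_sum k) \<Longrightarrow> (f x, u) \<in> omega_pow k \<and> f x \<noteq> u"
    and s: "s = natLeq \<or> s = natLeq_on (k + 2)"
  shows "\<exists>g v. strict_emb (omega_sum (Suc k)) (ord_mult (omega_pow k) s) g \<and>
     v \<in> Field (ord_mult (omega_pow k) s) \<and>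
     (\<forall>x\<in>Field (omega_sum (Suc k)). (g x, v) \<in> ord_mult (omega_pow k) s \<and> g x \<noteq> v)"
proof -
  \<comment> \<open>The leading summand occupies the copies \<open>0\<close> to \<open>k\<close>
    with the same codes, hence \<open>id\<close>; the tail goes to the first free copy.\<close>
  let ?g = "case_sum id (\<lambda>z. prod_encode (f z, k + 1)) \<circ> sum_decode"
  let ?v = "prod_encode (u, k + 1)"
  let ?n = "natLeq_on (k + 1)"
  have sW: "Well_order s"
    using s natLeq_Well_order natLeq_on_Well_order by auto
  have Fs: "y \<in> Field s" if "y \<le> k + 1" for y
    using s that by (auto simp: Field_natLeq Field_natLeq_on)
  have sI: "(y, y') \<in> s" if "y \<le> y'" "y' \<le> k + 1" for y y'
    using s that by (auto simp: natLeq_def)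
  have Fn: "Field ?n = {x. x < k + 1}" by (rule Field_natLeq_on)
  note FM = Field_ord_mult[OF Well_order_omega_pow sW]
  note FN = Field_ord_mult[OF Well_order_omega_pow natLeq_on_Well_order]
  have fF: "f z \<in> Field (omega_pow k)" if "z \<in> Field (omega_sum k)" for z
    using f that unfolding strict_emb_def by blast
  have FS: "Field (omega_sum (Suc k)) = sum_encode ` (Inl ` prod_encode `
      (Field (omega_pow k) \<times> {x. x < k + 1}) \<union> Inr ` Field (omega_sum k))"
    unfolding omega_sum.simps Field_ord_add FN Fn ..
  have "strict_emb (omega_sum (Suc k)) (ord_mult (omega_pow k) s) ?g"
  proof (rule strict_embI)
    fix x assume "x \<in> Field (omega_sum (Suc k))"
    then show "?g x \<in> Field (ord_mult (omega_pow k) s)"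
      unfolding FS FM using fF Fs by auto
  next
    fix p p' assume pp: "(p, p') \<in> omega_sum (Suc k)" "p \<noteq> p'"
    obtain z z' where z: "p = sum_encode z" "p' = sum_encode z'"
      by (metis sum_decode_inverse)
    show "(?g p, ?g p') \<in> ord_mult (omega_pow k) s \<and> ?g p \<noteq> ?g p'"
    proof (cases z)
      case (Inl a)
      show ?thesis
      proof (cases z')
        case (Inl a')
        then show ?thesis using pp \<open>z = Inl a\<close> unfolding z
          by (auto simp: ord_add_iff ord_mult_iff Field_natLeq_on elim!: ord_mult_cases intro!: Fs sI)
      next
        case (Inr b')
        then show ?thesis using pp \<open>z = Inl a\<close> fF unfolding z
          by (auto simp: ord_add_iff ord_mult_iff FN Field_natLeq_on intro!: Fs sI)
      qed
    next
      case (Inr b)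
      show ?thesis
      proof (cases z')
        case (Inl a')
        then show ?thesis using pp \<open>z = Inr b\<close> unfolding z by (auto simp: ord_add_iff)
      next
        case (Inr b')
        then have b: "(b, b') \<in> omega_sum k" "b \<noteq> b'"
          using pp \<open>z = Inr b\<close> unfolding z by (auto simp: ord_add_iff)
        then have "(f b, f b') \<in> omega_pow k" "f b \<noteq> f b'"
          using f unfolding strict_emb_def by blast+
        then show ?thesis using \<open>z = Inr b\<close> Inr Fs[of "k + 1"] unfolding z
          by (simp add: ord_mult_iff FieldI1 FieldI2)
      qed
    qed
  qed
  moreover have "?v \<in> Field (ord_mult (omega_pow k) s)"
    unfolding FM using u Fs by auto
  moreover have "\<forall>x\<in>Field (omega_sum (Suc k)).
      (?g x, ?v) \<in> ord_mult (omega_pow k) s \<and> ?g x \<noteq> ?v"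
    unfolding FS using u fF by (auto simp: ord_mult_iff intro!: Fs sI)
  ultimately show ?thesis by blast
qed

text \<open>The bound \<open>u\<close> is carried along because a mere embedding would give only
  \<open>\<le>o\<close>, and because the next step needs it as its own bound.\<close>

lemma omega_sum_bounded:
  "\<exists>f u. strict_emb (omega_sum k) (omega_pow k) f \<and> u \<in> Field (omega_pow k) \<and>
     (\<forall>x\<in>Field (omega_sum k). (f x, u) \<in> omega_pow k \<and> f x \<noteq> u)"
proof (induction k)
  case 0
  then show ?case by (auto simp: strict_emb_def Field_def)
next
  case (Suc k)
  then obtain f u where "strict_emb (omega_sum k) (omega_pow k) f" "u \<in> Field (omega_pow k)"
     "\<And>x. x \<in> Field (omega_sum k) \<Longrightarrow> (f x, u) \<in> omega_pow k \<and> f x \<noteq> u" by blast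
  from strict_emb_omega_sum_bounded[OF this, of natLeq] show ?case
    unfolding omega_pow.simps by blast
qed

lemma omega_sum_less_pow: "omega_sum k <o omega_pow k"
  using omega_sum_bounded[of k]
  by (auto intro: strict_emb_bounded_ordLess[OF Well_order_omega_sum Well_order_omega_pow])

lemma omega_sum_less_mult:
  "omega_sum (Suc k) <o ord_mult (omega_pow k) (natLeq_on (k + 2))"
proof -
  obtain f u where "strict_emb (omega_sum k) (omega_pow k) f" "u \<in> Field (omega_pow k)"
     "\<And>x. x \<in> Field (omega_sum k) \<Longrightarrow> (f x, u) \<in> omega_pow k \<and> f x \<noteq> u"
    using omega_sum_bounded[of k] by blast
  from strict_emb_omega_sum_bounded[OF this, of "natLeq_on (k + 2)"] show ?thesis
    using strict_emb_bounded_ordLess[OF Well_order_omega_sum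
          Well_order_ord_mult[OF Well_order_omega_pow natLeq_on_Well_order]] by blast
qed

text \<open>This is the additive indecomposability of \<open>\<omega>\<^sup>k\<close>.\<close>

lemma omega_pow_pigeonhole:
  assumes "finite C" "\<And>x. x \<in> Field (omega_pow k) \<Longrightarrow> c x \<in> C"
  shows "\<exists>h. \<exists>i\<in>C. strict_emb (omega_pow k) (omega_pow k) h \<and> (\<forall>x\<in>Field (omega_pow k). c (h x) = i)"
  using assms(2)
proof (induction k arbitrary: c)
  case 0
  have "strict_emb (omega_pow 0) (omega_pow 0) id" by (rule strict_emb_id)
  moreover have "c 0 \<in> C" using 0 by (simp add: Field_omega_pow_0 del: omega_pow.simps)
  ultimately show ?case
    unfolding Field_omega_pow_0 by fastforce
next
  case (Suc k)
  let ?W = "omega_pow k"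
  have FS: "Field (omega_pow (Suc k)) = prod_encode ` (Field ?W \<times> UNIV)"
    unfolding omega_pow.simps Field_ord_mult[OF Well_order_omega_pow natLeq_Well_order] Field_natLeq ..
  \<comment> \<open>Each copy \<open>y\<close> of \<open>\<omega>^k\<close> is first thinned to a
    single colour, later called \<open>i y\<close>.\<close>
  have "\<exists>h. \<exists>i\<in>C. strict_emb ?W ?W h \<and> (\<forall>x\<in>Field ?W. c (prod_encode (h x, y)) = i)" for y
    by (rule Suc.IH) (auto intro: Suc.prems simp: FS simp del: omega_pow.simps)
  then obtain h i where i: "\<And>y. i y \<in> C" and h: "\<And>y. strict_emb ?W ?W (h y)"
    and c: "\<And>y x. x \<in> Field ?W \<Longrightarrow> c (prod_encode (h y x, y)) = i y" by metis
  \<comment> \<open>Infinitely many copies share a colour; enumerating them increasingly by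
    \<open>e\<close> gives \<open>\<omega>\<close> many copies again.\<close>
  have "finite (range i)" using i assms(1) by (meson finite_subset image_subsetI)
  then obtain y0 where "infinite {y. i y = i y0}"
    using pigeonhole_infinite[of UNIV i] by auto
  then obtain e :: "nat \<Rightarrow> nat" where e: "strict_mono e" "\<And>n. e n \<in> {y. i y = i y0}"
    using infinite_enumerate[of "{y. i y = i y0}"] by blast
  let ?h = "\<lambda>p. case prod_decode p of (x, y) \<Rightarrow> prod_encode (h (e y) x, e y)"
  have hF: "h y x \<in> Field ?W" if "x \<in> Field ?W" for x y
    using h that unfolding strict_emb_def by blast
  have "strict_emb (omega_pow (Suc k)) (omega_pow (Suc k)) ?h"
  proof (rule strict_embI)
    fix x assume "x \<in> Field (omega_pow (Suc k))"
    then show "?h x \<in> Field (omega_pow (Suc k))" unfolding FS using hF by auto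
  next
    fix p p' assume pp: "(p, p') \<in> omega_pow (Suc k)" "p \<noteq> p'"
    then obtain x y x' y' where p: "p = prod_encode (x, y)" "p' = prod_encode (x', y')"
      and x: "x \<in> Field ?W" "x' \<in> Field ?W"
      and d: "y \<noteq> y' \<and> (y, y') \<in> natLeq \<or> y = y' \<and> (x, x') \<in> ?W"
      unfolding omega_pow.simps by (blast elim: ord_mult_cases)
    from d show "(?h p, ?h p') \<in> omega_pow (Suc k) \<and> ?h p \<noteq> ?h p'"
    proof
      assume "y \<noteq> y' \<and> (y, y') \<in> natLeq"
      then have "e y < e y'" using strict_monoD[OF e(1), of y y'] by (auto simp: natLeq_def)
      then show ?thesis using x hF by (simp add: p ord_mult_iff Field_natLeq) (simp add: natLeq_def)
    next
      assume d: "y = y' \<and> (x, x') \<in> ?W"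
      then have "(h (e y) x, h (e y) x') \<in> ?W \<and> h (e y) x \<noteq> h (e y) x'"
        using h pp(2) p unfolding strict_emb_def by blast
      then show ?thesis using x hF d by (auto simp: p ord_mult_iff Field_natLeq)
    qed
  qed
  moreover have "\<forall>x\<in>Field (omega_pow (Suc k)). c (?h x) = i y0"
    unfolding FS using c e(2) by simp
  ultimately show ?case using i[of y0] by blast
qed

text \<open>The monotone \<open>g\<close> cuts \<open>S\<close> into consecutive fibres:
  \<open>g x\<close> is the significant coordinate and the position inside the fibre the other one.
  The condition involving \<open>natLeq\<close> makes \<open>s\<close> extend the usual order on its
  field, which covers both \<open>natLeq\<close> and \<open>natLeq_on n\<close>.\<close>

lemma strict_emb_real_mult:
  assumes r: "Well_order r" and s: "Well_order s" "natLeq \<inter> Field s \<times> Field s \<subseteq> s"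
    and g: "\<And>x. x \<in> S \<Longrightarrow> g x \<in> Field s" "\<And>x y. x \<in> S \<Longrightarrow> y \<in> S \<Longrightarrow> x \<le> y \<Longrightarrow> g x \<le> g y"
    and fib: "\<And>i. \<exists>f. strict_emb (real_order_on {x\<in>S. g x = i}) r f"
  shows "\<exists>f. strict_emb (real_order_on S) (ord_mult r s) f"
proof -
  from fib obtain f where f: "\<And>i. strict_emb (real_order_on {x\<in>S. g x = i}) r (f i)" by metis
  let ?f = "\<lambda>x. prod_encode (f (g x) x, g x)"
  have fF: "f (g x) x \<in> Field r" if "x \<in> S" for x
    using f[of "g x"] that unfolding strict_emb_def by auto
  have "strict_emb (real_order_on S) (ord_mult r s) ?f"
  proof (rule strict_embI)
    fix x assume "x \<in> Field (real_order_on S)"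
    then show "?f x \<in> Field (ord_mult r s)" using fF g by (auto simp: Field_ord_mult[OF r s(1)])
  next
    fix x y assume xy: "(x, y) \<in> real_order_on S" "x \<noteq> y"
    then have S: "x \<in> S" "y \<in> S" "x \<le> y" by (auto simp: real_order_on_def)
    have le: "(g x, g y) \<in> s" using g S s(2) by (auto simp: natLeq_def)
    have "(f (g x) x, f (g x) y) \<in> r \<and> f (g x) x \<noteq> f (g x) y" if "g x = g y"
      using f[of "g x"] that xy unfolding strict_emb_def real_order_on_def by auto
    then show "(?f x, ?f y) \<in> ord_mult r s \<and> ?f x \<noteq> ?f y"
      using S fF g le by (auto simp: ord_mult_iff)
  qed
  then show ?thesis by blast
qed

section \<open>Binary digits\<close>

lemma finite_bits: "finite {k. bit (n::nat) k}"
proof (rule finite_subset)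
  show "{k. bit n k} \<subseteq> {..<n}"
  proof
    fix k assume "k \<in> {k. bit n k}"
    then have "odd (n div 2 ^ k)" by (simp add: bit_iff_odd)
    then have "2 ^ k \<le> n" by (metis div_less even_zero not_less)
    with less_exp[of k] have "k < n" by (rule less_le_trans)
    then show "k \<in> {..<n}" by simp
  qed
qed simp

lemma nu2_0 [simp]: "nu2 0 = 0"
  by (simp add: nu2_def)

lemma nu2_double [simp]: "nu2 (2 * n) = nu2 n"
proof -
  have "{k. bit (2 * n) k} = Suc ` {k. bit n k}"
    by (auto simp: bit_double_iff image_iff gr0_conv_Suc)
  then show ?thesis unfolding nu2_def by (simp add: card_image)
qed

lemma nu2_Suc_double [simp]: "nu2 (Suc (2 * n)) = Suc (nu2 n)"
proof -
  have "bit (Suc (2 * n)) k \<longleftrightarrow> k = 0 \<or> (\<exists>j. k = Suc j \<and> bit n j)" for k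
    by (cases k) (auto simp: bit_0 bit_Suc)
  then have "{k. bit (Suc (2 * n)) k} = insert 0 (Suc ` {k. bit n k})" by auto
  then show ?thesis unfolding nu2_def by (simp add: card_image finite_bits)
qed

lemma nu2_1 [simp]: "nu2 (Suc 0) = 1"
  using nu2_Suc_double[of 0] by simp

lemma nu2_eq_0_iff [simp]: "nu2 n = 0 \<longleftrightarrow> n = 0"
proof (induction n rule: less_induct)
  case (less n)
  show ?case
  proof (cases "even n")
    case True
    then obtain m where m: "n = 2 * m" by blast
    then show ?thesis using less[of m] by (cases "m = 0") auto
  next
    case False
    then obtain m where "n = Suc (2 * m)" by (metis oddE Suc_eq_plus1)
    then show ?thesis by simp
  qed
qed

lemma nu2_Suc_le: "nu2 (Suc n) \<le> Suc (nu2 n)"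
proof (induction n rule: less_induct)
  case (less n)
  show ?case
  proof (cases "even n")
    case True
    then obtain m where "n = 2 * m" by blast
    then show ?thesis by simp
  next
    case False
    then obtain m where m: "n = Suc (2 * m)" by (metis oddE Suc_eq_plus1)
    have "nu2 (2 * Suc m) \<le> Suc (nu2 m)" unfolding nu2_double using less[of m] m by simp
    then show ?thesis using m by simp
  qed
qed

text \<open>Induction on removing the last digits. Only \<open>1 + 1\<close> carries: it loses two
  ones, while the carry adds at most one by \<open>nu2_Suc_le\<close>.\<close>

lemma nu2_add_le: "nu2 (m + n) \<le> nu2 m + nu2 n"
proof (induction m arbitrary: n rule: less_induct)
  case (less m)
  obtain a b c d where m: "m = 2 * a + b" "b < 2" and n: "n = 2 * c + d" "d < 2"
    by (metis mod_less_divisor mult_div_mod_eq pos2)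
  show ?case
  proof (cases "a < m")
    case True
    note ac = less[OF True, of c] nu2_Suc_le[of "a + c"]
    have bd: "b = 0 \<or> b = 1" "d = 0 \<or> d = 1" using m n by auto
    have e: "m + n = 2 * (a + c) + (b + d)" using m n by simp
    from bd show ?thesis
    proof (elim disjE)
      assume "b = 0" "d = 0" then show ?thesis using e ac m n by (simp del: distrib_left_numeral)
    next
      assume "b = 0" "d = 1" then show ?thesis using e ac m n by (simp del: distrib_left_numeral)
    next
      assume "b = 1" "d = 0" then show ?thesis using e ac m n by (simp del: distrib_left_numeral)
    next
      assume bd: "b = 1" "d = 1"
      then have "m + n = 2 * (Suc (a + c))" using e by simp
      then have "nu2 (m + n) = nu2 (Suc (a + c))" by (simp only: nu2_double)
      then show ?thesis using ac bd m n by simp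
    qed
  next
    case False
    then have "m = 0" using m by auto
    then show ?thesis by simp
  qed
qed

lemma nu2_mult_pow [simp]: "nu2 (2 ^ k * n) = nu2 n"
  by (induction k) (simp_all add: mult.assoc)

lemma nu2_pow_add: "v < 2 ^ t \<Longrightarrow> nu2 (2 ^ t + v) = Suc (nu2 v)"
proof (induction t arbitrary: v)
  case 0
  then show ?case by simp
next
  case (Suc t)
  show ?case
  proof (cases "even v")
    case True
    then obtain w where w: "v = 2 * w" by blast
    then have "nu2 (2 * (2 ^ t + w)) = Suc (nu2 w)" unfolding nu2_double using Suc by simp
    then show ?thesis using w by simp
  next
    case False
    then obtain w where w: "v = Suc (2 * w)" by (metis oddE Suc_eq_plus1)
    then have "nu2 (Suc (2 * (2 ^ t + w))) = Suc (Suc (nu2 w))" unfolding nu2_Suc_double using Suc by simp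
    then show ?thesis using w by simp
  qed
qed

section \<open>Leading digit and binary logarithm\<close>

lemma nat_binary_decomp:
  assumes "1 \<le> (n::nat)" obtains t v where "n = 2 ^ t + v" "v < 2 ^ t"
proof -
  obtain t where "2 ^ t \<le> n" "n < 2 ^ (t + 1)"
    using ex_power_ivl1[of 2 n] assms by auto
  then show ?thesis by (intro that[of t "n - 2 ^ t"]) auto
qed

lemma real_div_pow_less_1: "v < 2 ^ t \<Longrightarrow> real v / 2 ^ t < 1"
  by (metis divide_less_eq_1_pos of_nat_less_iff of_nat_numeral of_nat_power zero_less_numeral
      zero_less_power)

lemma floor_log_binary:
  assumes "v < 2 ^ t"
  shows "\<lfloor>log 2 (real (2 ^ t + v))\<rfloor> = int t"
proof -
  have "real v < 2 ^ t" using assms by (metis of_nat_less_iff of_nat_numeral of_nat_power)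
  then show ?thesis by (intro floor_log_eq_powr_iff[THEN iffD2]) (auto simp: powr_realpow powr_add add_pos_nonneg)
qed

lemma log_binary:
  "log 2 (real (2 ^ t + v)) = t + log 2 (1 + real v / 2 ^ t)"
proof -
  have "real (2 ^ t + v) = 2 ^ t * (1 + real v / 2 ^ t)" by (simp add: field_simps)
  moreover have "1 + real v / 2 ^ t > 0" by (simp add: add_pos_nonneg)
  ultimately show ?thesis by (simp add: log_mult log_nat_power)
qed

section \<open>Few binary digits for bounded defect\<close>

lemma addition_chain_bounds:
  assumes "addition_chain a" "k < length a"
  shows "1 \<le> a ! k \<and> a ! k \<le> 2 ^ k"
  using assms(2)
proof (induction k rule: less_induct)
  case (less k)
  show ?case
  proof (cases k)
    case 0
    then show ?thesis using assms(1) by (simp add: addition_chain_def)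
  next
    case (Suc k')
    then have "1 \<le> k" by simp
    then obtain i j where ij: "i < k" "j < k" "a ! k = a ! i + a ! j"
      using assms(1) less.prems unfolding addition_chain_def by blast
    have "a ! i \<le> 2 ^ i" "a ! j \<le> 2 ^ j" "1 \<le> a ! i"
      using less.IH[of i] less.IH[of j] ij less.prems by auto
    moreover have "(2::nat) ^ i \<le> 2 ^ k'" "(2::nat) ^ j \<le> 2 ^ k'" using ij Suc by simp_all
    ultimately have "a ! i + a ! j \<le> 2 ^ k' + 2 ^ k'" "1 \<le> a ! i" by linarith+
    then show ?thesis using ij Suc by simp
  qed
qed

text \<open>The counter \<open>f\<close> counts the non-doubling steps. With \<open>M\<close> the largest and \<open>M'\<close> (a bound for)
  the second largest entry, a doubling multiplies \<open>3 M + 2 M'\<close> by at most \<open>2\<close>, any other step by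
  at most \<open>5/3\<close>; this is a rational variant of Knuth's Fibonacci estimate.\<close>

lemma addition_chain_potential:
  assumes "addition_chain a" "k < length a"
  shows "\<exists>f M M'. f \<le> k \<and> (\<forall>i\<le>k. nu2 (a ! i) \<le> 2 ^ f \<and> (real (a ! i) \<le> M' \<or> real (a ! i) = M)) \<and>
    M' \<le> M \<and> M \<le> 2 * M' \<and> 3 * M + 2 * M' \<le> 5 * 2 ^ k * (5 / 6) ^ f"
  using assms(2)
proof (induction k)
  case 0
  \<comment> \<open>\<open>M = M' = 1\<close> gives potential \<open>5\<close>, the constant in the
    bound.\<close>
  then show ?case using assms(1)
    by (intro exI[of _ 0] exI[of _ "1::real"]) (auto simp: addition_chain_def)
next
  case (Suc k)
  then obtain f M M' where f: "f \<le> k" and nu: "\<And>i. i \<le> k \<Longrightarrow> nu2 (a ! i) \<le> 2 ^ f"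
    and M: "\<And>i. i \<le> k \<Longrightarrow> real (a ! i) \<le> M' \<or> real (a ! i) = M"
    and MM: "M' \<le> M" "M \<le> 2 * M'" and W: "3 * M + 2 * M' \<le> 5 * 2 ^ k * (5 / 6) ^ f"
    by (metis Suc_lessD)
  obtain i j where ij: "i \<le> k" "j \<le> k" "a ! Suc k = a ! i + a ! j"
    using assms(1) Suc.prems unfolding addition_chain_def by (metis less_Suc_eq_le le_add1 plus_1_eq_Suc)
  define x where "x = real (a ! Suc k)"
  have le_M: "real (a ! i) \<le> M" if "i \<le> k" for i using M[OF that] MM by auto
  have split: "l \<le> k \<or> l = Suc k" if "l \<le> Suc k" for l using that by auto
  \<comment> \<open>\<open>N\<close> and \<open>N'\<close> update the largest and second largest
    entry: a new entry not above \<open>M\<close> affects only the second place, a larger one pushes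
    \<open>M\<close> there.\<close>
  define N where "N = max M x"
  define N' where "N' = (if x \<le> M then max M' x else M)"
  have N: "real (a ! l) \<le> N' \<or> real (a ! l) = N" if "l \<le> Suc k" for l
    using split[OF that] M[of l] le_M[of l] MM unfolding N_def N'_def x_def by (auto simp: max_def)
  have x2: "x \<le> 2 * M" using le_M[OF ij(1)] le_M[OF ij(2)] ij unfolding x_def by simp
  have NN: "N' \<le> N" "N \<le> 2 * N'"
    using MM x2 unfolding N_def N'_def by (auto simp: max_def)
  show ?case
  proof (cases "a ! i = a ! j")
    case True
    \<comment> \<open>If \<open>x\<close> exceeds \<open>M\<close>, the new potential is at most
      \<open>3 * (2 * M) + 2 * M = 8 * M\<close>; here \<open>M \<le> 2 * M'\<close> is what makes
      the factor \<open>2\<close> suffice.\<close>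
    have "3 * N + 2 * N' \<le> 2 * (3 * M + 2 * M')"
      using MM x2 unfolding N_def N'_def by (auto simp: max_def)
    then have "3 * N + 2 * N' \<le> 5 * 2 ^ Suc k * (5 / 6) ^ f" using W by simp
    moreover have "nu2 (a ! l) \<le> 2 ^ f" if "l \<le> Suc k" for l
      using split[OF that] nu[of l] nu[OF ij(2)] ij True by (auto simp flip: mult_2)
    ultimately show ?thesis using N NN f by (intro exI[of _ f] exI[of _ N] exI[of _ N']) auto
  next
    case False
    \<comment> \<open>Two different values cannot both be \<open>M\<close>. The new potential is
      then at most \<open>5 * M + 3 * M'\<close>, whence the factor
      \<open>5 / 3 = 2 * (5 / 6)\<close>.\<close>
    then have "x \<le> M + M'"
      using M[OF ij(1)] M[OF ij(2)] le_M[OF ij(1)] le_M[OF ij(2)] ij unfolding x_def by auto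
    then have "3 * N + 2 * N' \<le> 5 / 3 * (3 * M + 2 * M')"
      using MM unfolding N_def N'_def by (auto simp: max_def)
    then have "3 * N + 2 * N' \<le> 5 * 2 ^ Suc k * (5 / 6) ^ Suc f" using W by simp
    moreover have "nu2 (a ! l) \<le> 2 ^ Suc f" if "l \<le> Suc k" for l
      using split[OF that] nu[of l] nu[OF ij(2)] nu[OF ij(1)] ij nu2_add_le[of "a ! i" "a ! j"] by auto
    ultimately show ?thesis using N NN f
      by (intro exI[of _ "Suc f"] exI[of _ N] exI[of _ N']) auto
  qed
qed

text \<open>For length \<open>k\<close> the defect bound gives
  \<open>2 ^ k \<le> 2 powr r * n\<close>, while the potential is at least \<open>3 * n\<close>.
  Hence \<open>(6 / 5) ^ f \<le> 5 / 3 * 2 powr r\<close>, which bounds the number \<open>f\<close>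
  of non-doublings independently of the chain and of \<open>n\<close>.\<close>

lemma nu2_bounded:
  "\<exists>B. \<forall>a n. addition_chain_for a n \<and> real (length a - 1) - log 2 (real n) \<le> r \<longrightarrow> nu2 n \<le> B"
proof -
  obtain F where F: "5 / 3 * 2 powr r < (6 / 5 :: real) ^ F"
    using real_arch_pow[of "6 / 5" "5 / 3 * 2 powr r"] by auto
  have "nu2 n \<le> 2 ^ F" if a: "addition_chain a" "last a = n"
    and r: "real (length a - 1) - log 2 (real n) \<le> r" for a n
  proof -
    let ?k = "length a - 1"
    have k: "?k < length a" and n: "n = a ! ?k"
      using a by (auto simp: addition_chain_def last_conv_nth)
    have n1: "1 \<le> n" using addition_chain_bounds[OF a(1) k] n by simp
    obtain f M M' where f: "nu2 n \<le> 2 ^ f" "real n \<le> M" "0 \<le> M'"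
      and W: "3 * M + 2 * M' \<le> 5 * 2 ^ ?k * (5 / 6) ^ f"
    proof -
      from addition_chain_potential[OF a(1) k] obtain f M M'
        where *: "\<forall>i\<le>?k. nu2 (a ! i) \<le> 2 ^ f \<and> (real (a ! i) \<le> M' \<or> real (a ! i) = M)"
          "M' \<le> M" "M \<le> 2 * M'" "3 * M + 2 * M' \<le> 5 * 2 ^ ?k * (5 / 6) ^ f" by blast
      then have "nu2 n \<le> 2 ^ f" "real n \<le> M' \<or> real n = M" using n by auto
      then show ?thesis using * that[of f M M'] by auto
    qed
    have "(2::real) ^ ?k = 2 powr ?k" by (simp add: powr_realpow)
    also have "\<dots> \<le> 2 powr (r + log 2 n)" using r by (intro powr_mono) auto
    also have "\<dots> = 2 powr r * n" using n1 by (simp add: powr_add)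
    finally have k': "(2::real) ^ ?k \<le> 2 powr r * n" .
    have "3 * real n \<le> 5 * 2 ^ ?k * (5 / 6) ^ f" using W f by linarith
    also have "\<dots> \<le> 5 * (2 powr r * n) * (5 / 6) ^ f"
      using k' by (intro mult_right_mono mult_left_mono) auto
    finally have "3 \<le> 5 * 2 powr r * (5 / 6) ^ f" using n1 by (simp add: field_simps)
    moreover have "(5 / 6 :: real) ^ f * (6 / 5) ^ f = 1" by (simp flip: power_mult_distrib)
    ultimately have "3 * (6 / 5) ^ f \<le> 5 * 2 powr r"
      using mult_right_mono[of 3 "5 * 2 powr r * (5 / 6) ^ f" "(6 / 5) ^ f"] by (simp add: mult.assoc)
    then have "(6 / 5 :: real) ^ f < (6 / 5) ^ F" using F by linarith
    then have "f < F" using power_less_imp_less_exp[of "6 / 5 :: real"] by simp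
    then have "(2::nat) ^ f \<le> 2 ^ F" by simp
    then show ?thesis using f(1) by linarith
  qed
  then show ?thesis unfolding addition_chain_for_def by blast
qed

section \<open>Defects of an admissible set of chains\<close>

lemma chain_len_attained:
  assumes "admissible A" "1 \<le> n"
  obtains a where "a \<in> A" "addition_chain_for a n" "length a - 1 = chain_len A n"
proof -
  have "\<exists>r. \<exists>a\<in>A. addition_chain_for a n \<and> r = length a - 1"
    using assms unfolding admissible_def by blast
  from LeastI_ex[OF this] show ?thesis using that unfolding chain_len_def by auto
qed

lemma le_pow_chain_len:
  assumes "admissible A" "1 \<le> n"
  shows "n \<le> 2 ^ chain_len A n"
proof -
  obtain a where a: "addition_chain_for a n" "length a - 1 = chain_len A n"
    using chain_len_attained[OF assms] by metis
  then have "a \<noteq> []" "addition_chain a" "n = a ! chain_len A n"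
    by (auto simp: addition_chain_for_def addition_chain_def last_conv_nth)
  then show ?thesis using addition_chain_bounds[of a "chain_len A n"] a(2) by (cases a) auto
qed

lemma defect_nonneg:
  assumes "admissible A" "1 \<le> n"
  shows "0 \<le> defect A n"
proof -
  have "real n \<le> 2 ^ chain_len A n"
    using le_pow_chain_len[OF assms] by (metis of_nat_le_iff of_nat_numeral of_nat_power)
  then have "log 2 n \<le> chain_len A n" using assms(2) by (simp add: log_le_iff powr_realpow)
  then show ?thesis by (simp add: defect_def)
qed

text \<open>At least \<open>t\<close> steps are needed since entries at most double; admissibility
  allows at most \<open>t + nu2 v\<close>, as \<open>nu2 (2 ^ t + v) - 1 = nu2 v\<close>.\<close>

lemma chain_len_binary:
  assumes A: "admissible A" and v: "v < 2 ^ t"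
  obtains s where "s \<le> nu2 v" "chain_len A (2 ^ t + v) = t + s"
    "defect A (2 ^ t + v) = s - log 2 (1 + real v / 2 ^ t)"
proof -
  let ?n = "2 ^ t + v"
  have n: "1 \<le> ?n" by (simp add: add_increasing2)
  have "2 ^ t \<le> (2::nat) ^ chain_len A ?n" using le_pow_chain_len[OF A n] by linarith
  then have t: "t \<le> chain_len A ?n" by simp
  have "int (chain_len A ?n) \<le> \<lfloor>log 2 (real ?n)\<rfloor> + int (nu2 ?n) - 1"
    using A n unfolding admissible_def by blast
  then have "chain_len A ?n - t \<le> nu2 v"
    unfolding floor_log_binary[OF v] nu2_pow_add[OF v] by simp
  moreover have "defect A ?n = real (chain_len A ?n - t) - log 2 (1 + real v / 2 ^ t)"
    unfolding defect_def log_binary using t by (simp add: of_nat_diff)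
  ultimately show ?thesis using that[of "chain_len A ?n - t"] t by simp
qed

text \<open>This makes the \<open>Max\<close> in \<open>qmax\<close> a genuine maximum;
  \<open>nu2_bounded\<close> is applied to shortest chains in \<open>A\<close>.\<close>

lemma finite_nu2_defect:
  assumes "admissible A"
  shows "finite {nu2 n | n. n \<ge> 1 \<and> defect A n \<le> r}"
proof -
  obtain B where B: "\<And>a n. addition_chain_for a n \<Longrightarrow>
      real (length a - 1) - log 2 (real n) \<le> r \<Longrightarrow> nu2 n \<le> B"
    using nu2_bounded[of r] by blast
  have "nu2 n \<le> B" if "n \<ge> 1" "defect A n \<le> r" for n
    using chain_len_attained[OF assms that(1)] B that(2) unfolding defect_def by metis
  then have "{nu2 n | n. n \<ge> 1 \<and> defect A n \<le> r} \<subseteq> {..B}" by auto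
  then show ?thesis by (rule finite_subset) simp
qed

lemma nu2_le_qmax:
  assumes "admissible A" "1 \<le> n" "defect A n \<le> r"
  shows "nu2 n \<le> qmax A r"
  unfolding qmax_def using assms by (intro Max_ge finite_nu2_defect) auto

text \<open>The number \<open>1\<close> has defect at most \<open>0\<close> and one binary digit
  one. Hence \<open>qmax A r - 1\<close> is a true predecessor.\<close>

lemma qmax_pos:
  assumes A: "admissible A" and r: "0 \<le> r"
  obtains q where "qmax A r = Suc q"
proof -
  obtain s where "s \<le> nu2 0" "defect A (2 ^ 0 + 0) = s - log 2 (1 + real 0 / 2 ^ 0)"
    using chain_len_binary[OF A, of 0 0] by auto
  then have "nu2 1 \<le> qmax A r" using r by (intro nu2_le_qmax[OF A]) auto
  then show ?thesis using that by (cases "qmax A r") auto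
qed

section \<open>The upper bound\<close>

lemma strict_emb_realI:
  assumes "\<And>x. x \<in> S \<Longrightarrow> f x \<in> Field s"
    and "\<And>x y. x \<in> S \<Longrightarrow> y \<in> S \<Longrightarrow> x < y \<Longrightarrow> (f x, f y) \<in> s \<and> f x \<noteq> f y"
  shows "strict_emb (real_order_on S) s f"
proof (rule strict_embI)
  show "f x \<in> Field s" if "x \<in> Field (real_order_on S)" for x
    using that assms(1) by simp
  show "(f x, f y) \<in> s \<and> f x \<noteq> f y" if "(x, y) \<in> real_order_on S" "x \<noteq> y" for x y
    using that assms(2)[of x y] by (auto simp: real_order_on_def)
qed

lemma strict_emb_realD:
  assumes "strict_emb (real_order_on S) s f"
  shows "x \<in> S \<Longrightarrow> f x \<in> Field s"
    and "x \<in> S \<Longrightarrow> y \<in> S \<Longrightarrow> x < y \<Longrightarrow> (f x, f y) \<in> s \<and> f x \<noteq> f y"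
  using assms unfolding strict_emb_def Field_real_order_on
  by (auto simp: real_order_on_def)

lemma omega_pow_nonempty: obtains u where "u \<in> Field (omega_pow k)"
  using omega_sum_bounded[of k] by blast

text \<open>Zero is left out because it has no leading digit; it arises only from powers of two,
  whose defect is \<open>0\<close>.\<close>

definition dyadics :: "nat \<Rightarrow> real set" where
  "dyadics k = {real u / 2 ^ j | u j. 0 < u \<and> u < 2 ^ j \<and> nu2 u \<le> k}"

lemma dyadics_range: "x \<in> dyadics k \<Longrightarrow> 0 < x \<and> x < 1"
  unfolding dyadics_def by (auto dest: real_div_pow_less_1)

text \<open>Splits off the leading digit: \<open>b\<close> is its position after the binary point
  and \<open>z\<close> the rescaled remainder, with one digit fewer.\<close>

lemma dyadics_decomp:
  assumes "x \<in> dyadics (Suc k)"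
  obtains b z where "x = (1 + z) / 2 ^ b" "z = 0 \<or> z \<in> dyadics k"
proof -
  obtain u j where u: "0 < u" "u < 2 ^ j" "nu2 u \<le> Suc k" "x = real u / 2 ^ j"
    using assms unfolding dyadics_def by blast
  obtain t v where v: "u = 2 ^ t + v" "v < 2 ^ t"
    using nat_binary_decomp[of u] u(1) by auto
  have "(2::nat) ^ t < 2 ^ j" using u(2) v(1) by linarith
  then have "t < j" by simp
  then have "(2::real) ^ j = 2 ^ (j - t) * 2 ^ t" by (simp flip: power_add)
  then have "x = (1 + real v / 2 ^ t) / 2 ^ (j - t)"
    using u(4) v(1) by (simp add: field_simps)
  moreover have "real v / 2 ^ t = 0 \<or> real v / 2 ^ t \<in> dyadics k"
    using v u(3) nu2_pow_add[OF v(2)] unfolding dyadics_def by (cases "v = 0") auto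
  ultimately show ?thesis by (rule that)
qed

lemma floor_log_dyadic:
  assumes "x = (1 + z) / 2 ^ b" "0 \<le> z" "z < 1"
  shows "nat (- \<lfloor>log 2 x\<rfloor>) = b"
proof -
  have "log 2 x = log 2 (1 + z) - b" using assms by (simp add: log_divide log_nat_power)
  moreover have "0 \<le> log 2 (1 + z)" "log 2 (1 + z) < 1" using assms by (auto simp: log_less_iff)
  ultimately have "\<lfloor>log 2 x\<rfloor> = - int b" by (intro floor_unique) auto
  then show ?thesis by simp
qed

text \<open>The position of the leading digit is the most significant coordinate. The power of two with
  that leading digit is the smallest such number, hence comes last in the reversed order, and is
  put in a fibre of its own.\<close>

lemma strict_emb_dyadics:
  "\<exists>f. strict_emb (real_order_on (uminus ` dyadics k)) (omega_pow k) f"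
proof (induction k)
  case 0
  have "dyadics 0 = {}" unfolding dyadics_def by auto
  then show ?case by (intro exI[of _ "\<lambda>_. 0"] strict_emb_realI) auto
next
  case (Suc k)
  then obtain F where F: "strict_emb (real_order_on (uminus ` dyadics k)) (omega_pow k) F" ..
  obtain u where u: "u \<in> Field (omega_pow k)" by (rule omega_pow_nonempty)
  define B where "B x = nat (- \<lfloor>log 2 x\<rfloor>)" for x :: real
  define Z where "Z x = 2 ^ B x * x - 1" for x
  \<comment> \<open>Doubling \<open>B\<close> leaves an odd index for the bare power of two, just
    after the fibre of the other fractions with the same leading digit.\<close>
  define g where "g y = 2 * B (- y) + (if Z (- y) = 0 then 1 else 0)" for y
  let ?S = "uminus ` dyadics (Suc k)"
  have Z: "0 \<le> Z x" "Z x = 0 \<or> Z x \<in> dyadics k" if x: "x \<in> dyadics (Suc k)" for x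
  proof -
    obtain b z where bz: "x = (1 + z) / 2 ^ b" "z = 0 \<or> z \<in> dyadics k"
      using dyadics_decomp[OF x] .
    then have z: "0 \<le> z" "z < 1" using dyadics_range[of z k] by auto
    have "B x = b" unfolding B_def by (rule floor_log_dyadic[OF bz(1) z])
    then have "Z x = z" unfolding Z_def bz(1) by simp
    then show "0 \<le> Z x" "Z x = 0 \<or> Z x \<in> dyadics k" using bz z by auto
  qed
  have B: "B x' \<le> B x" if "x \<in> dyadics (Suc k)" "x \<le> x'" for x x'
    using that dyadics_range[OF that(1)] unfolding B_def
    by (intro nat_mono) (auto intro!: floor_mono)
  have mono: "g x \<le> g y" if "x \<in> ?S" "y \<in> ?S" "x \<le> y" for x y
  proof (cases "B (- x) = B (- y)")
    case True
    then have "Z (- y) \<le> Z (- x)" using that unfolding Z_def by simp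
    moreover have "0 \<le> Z (- y)" using Z(1)[of "- y"] that by auto
    ultimately show ?thesis using True unfolding g_def by auto
  next
    case False
    then have "B (- x) < B (- y)" using B[of "- y" "- x"] that by force
    then show ?thesis unfolding g_def by auto
  qed
  have "\<exists>f. strict_emb (real_order_on {x \<in> ?S. g x = i}) (omega_pow k) f" for i
  proof (intro exI strict_emb_realI)
    let ?f = "\<lambda>y. if Z (- y) = 0 then u else F (- Z (- y))"
    show "?f y \<in> Field (omega_pow k)" if "y \<in> {x \<in> ?S. g x = i}" for y
      using that Z(2)[of "- y"] strict_emb_realD(1)[OF F] u by auto
    fix y y' assume y: "y \<in> {x \<in> ?S. g x = i}" and y': "y' \<in> {x \<in> ?S. g x = i}" and "y < y'"
    have g: "g y = g y'" using y y' by simp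
    have "even (g y) \<longleftrightarrow> Z (- y) \<noteq> 0" "even (g y') \<longleftrightarrow> Z (- y') \<noteq> 0" by (auto simp: g_def)
    then have zz: "Z (- y) = 0 \<longleftrightarrow> Z (- y') = 0" using g by simp
    have BB: "B (- y) = B (- y')" using g zz unfolding g_def by auto
    have lt: "Z (- y') < Z (- y)" unfolding Z_def BB using \<open>y < y'\<close> by simp
    \<comment> \<open>Two different points of a fibre have the same \<open>B\<close>, hence
      different remainders, so the fibre is not that of a bare power.\<close>
    then have nz: "Z (- y) \<noteq> 0" "Z (- y') \<noteq> 0" using zz by auto
    then have "Z (- y) \<in> dyadics k" "Z (- y') \<in> dyadics k"
      using Z(2)[of "- y"] Z(2)[of "- y'"] y y' by auto
    then show "(?f y, ?f y') \<in> omega_pow k \<and> ?f y \<noteq> ?f y'"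
      using strict_emb_realD(2)[OF F, of "- Z (- y)" "- Z (- y')"] lt nz by simp
  qed
  from strict_emb_real_mult[OF Well_order_omega_pow natLeq_Well_order _ _ mono this]
  show ?case by (auto simp: Field_natLeq)
qed

text \<open>As \<open>log 2 (1 + z)\<close> lies in \<open>[0, 1)\<close>, the ceiling of a defect
  recovers \<open>s\<close>, which takes at most \<open>q + 1\<close> values. For fixed
  \<open>s\<close>, the fraction is \<open>z = 2 powr (s - d) - 1\<close>, which decreases in
  \<open>d\<close>; hence the negated dyadics.\<close>

lemma strict_emb_defects:
  fixes S :: "real set"
  assumes A: "admissible A" and S: "S \<subseteq> {0..}"
    and n: "\<And>d. d \<in> S \<Longrightarrow> \<exists>n\<ge>1. nu2 n \<le> Suc q \<and> d = defect A n"
  shows "\<exists>f. strict_emb (real_order_on S) (ord_mult (omega_pow q) (natLeq_on (Suc q))) f"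
proof -
  obtain F where F: "strict_emb (real_order_on (uminus ` dyadics q)) (omega_pow q) F"
    using strict_emb_dyadics[of q] ..
  obtain u where u: "u \<in> Field (omega_pow q)" by (rule omega_pow_nonempty)
  define g where "g d = nat \<lceil>d\<rceil>" for d :: real
  have form: "g d \<le> q \<and> (d = 0 \<or> 2 powr (real (g d) - d) - 1 \<in> dyadics q)" if d: "d \<in> S" for d
  proof -
    obtain m where m: "m \<ge> 1" "nu2 m \<le> Suc q" "d = defect A m" using n[OF d] by blast
    obtain t v where v: "m = 2 ^ t + v" "v < 2 ^ t" using nat_binary_decomp[OF m(1)] .
    obtain s where s: "s \<le> nu2 v" "d = s - log 2 (1 + real v / 2 ^ t)"
      using chain_len_binary[OF A v(2)] m(3) v(1) by metis
    define z where "z = real v / 2 ^ t"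
    note s = s[folded z_def]
    have z: "0 \<le> z" "z < 1" using real_div_pow_less_1[OF v(2)] by (auto simp: z_def)
    then have l: "0 \<le> log 2 (1 + z)" "log 2 (1 + z) < 1" by (auto simp: log_less_iff)
    then have "\<lceil>d\<rceil> = int s" unfolding s(2) by (intro ceiling_unique) auto
    then have gd: "g d = s" by (simp add: g_def)
    have nv: "nu2 v \<le> q" using m(2) nu2_pow_add[OF v(2)] v(1) by simp
    have "2 powr (real (g d) - d) = 1 + z" unfolding gd using s(2) z by (simp add: add_pos_nonneg)
    moreover have "d = 0" if "v = 0" using that s by (simp add: z_def)
    moreover have "z \<in> dyadics q" if "v \<noteq> 0"
      using that nv v(2) unfolding dyadics_def z_def by blast
    ultimately show ?thesis using gd s(1) nv by fastforce
  qed
  \<comment> \<open>The defect \<open>0\<close> has a fibre to itself, so the filler value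
    \<open>u\<close> never competes with values of \<open>F\<close>.\<close>
  have pos: "0 < g d \<longleftrightarrow> d \<noteq> 0" if "d \<in> S" for d
    using that S by (auto simp: g_def order_less_le)
  have "\<exists>f. strict_emb (real_order_on {x \<in> S. g x = i}) (omega_pow q) f" for i
  proof (intro exI strict_emb_realI)
    let ?f = "\<lambda>d. if d = 0 then u else F (- (2 powr (real i - d) - 1))"
    show "?f d \<in> Field (omega_pow q)" if "d \<in> {x \<in> S. g x = i}" for d
    proof (cases "d = 0")
      case False
      then have "2 powr (real i - d) - 1 \<in> dyadics q" using form[of d] that by auto
      from strict_emb_realD(1)[OF F imageI[OF this]] False show ?thesis by simp
    qed (simp add: u)
    fix d d' assume d: "d \<in> {x \<in> S. g x = i}" and d': "d' \<in> {x \<in> S. g x = i}" and "d < d'"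
    then have nz: "d \<noteq> 0" "d' \<noteq> 0" using pos[of d] pos[of d'] by auto
    then have dy: "2 powr (real i - d) - 1 \<in> dyadics q" "2 powr (real i - d') - 1 \<in> dyadics q"
      using form[of d] form[of d'] d d' by auto
    have "2 powr (real i - d') < 2 powr (real i - d)" using \<open>d < d'\<close> by simp
    then show "(?f d, ?f d') \<in> omega_pow q \<and> ?f d \<noteq> ?f d'"
      using strict_emb_realD(2)[OF F imageI[OF dy(1)] imageI[OF dy(2)]] nz by simp
  qed
  moreover have "g d \<in> Field (natLeq_on (Suc q))" if "d \<in> S" for d
    using form[OF that] by (simp only: Field_natLeq_on) simp
  moreover have "g d \<le> g d'" if "d \<le> d'" for d d'
    unfolding g_def using that by (intro nat_mono ceiling_mono)
  moreover have
    "natLeq \<inter> Field (natLeq_on (Suc q)) \<times> Field (natLeq_on (Suc q)) \<subseteq> natLeq_on (Suc q)"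
    unfolding Field_natLeq_on by (auto simp: natLeq_def)
  ultimately show ?thesis
    by (intro strict_emb_real_mult[OF Well_order_omega_pow natLeq_on_Well_order, where g = g]) auto
qed

text \<open>\<open>\<omega>^q (q+1)\<close> is the leading summand, so the sharper bound by this
  product implies the one by the sum.\<close>

lemma strict_emb_omega_sum:
  "strict_emb (ord_mult (omega_pow q) (natLeq_on (Suc q))) (omega_sum (Suc q)) (\<lambda>x. sum_encode (Inl x))"
  unfolding omega_sum.simps strict_emb_def Field_ord_add Suc_eq_plus1[symmetric]
  by (auto simp: ord_add_iff inj_eq[OF inj_sum_encode])

section \<open>The lower bound\<close>

text \<open>The coordinates encode digit positions: a larger significant coordinate moves the
  leading digit further right, which makes the fraction smaller.\<close>

lemma omega_pow_dyadic:
  "\<exists>\<phi>::nat \<Rightarrow> real. (\<forall>x\<in>Field (omega_pow k). \<exists>u j. u < 2 ^ j \<and> nu2 u = k \<and> \<phi> x = real u / 2 ^ j) \<and>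
     (\<forall>x y. (x, y) \<in> omega_pow k \<and> x \<noteq> y \<longrightarrow> \<phi> y < \<phi> x)"
proof (induction k)
  case 0
  show ?case by (intro exI[of _ "\<lambda>_. 0"]) (auto intro!: exI[of _ 0])
next
  case (Suc k)
  let ?W = "omega_pow k"
  from Suc obtain \<phi> :: "nat \<Rightarrow> real"
    where \<phi>: "\<And>x. x \<in> Field ?W \<Longrightarrow> \<exists>u j. u < 2 ^ j \<and> nu2 u = k \<and> \<phi> x = real u / 2 ^ j"
      and dec: "\<And>x y. (x, y) \<in> ?W \<Longrightarrow> x \<noteq> y \<Longrightarrow> \<phi> y < \<phi> x" by blast
  have range: "0 \<le> \<phi> x" "\<phi> x < 1" if "x \<in> Field ?W" for x
    using \<phi>[OF that] real_div_pow_less_1 by auto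
  \<comment> \<open>The exponent is \<open>Suc y\<close>, not \<open>y\<close>, to keep the value
    below \<open>1\<close>.\<close>
  define \<psi> where "\<psi> p = (case prod_decode p of (x, y) \<Rightarrow> (1 + \<phi> x) / 2 ^ Suc y)" for p
  have "\<exists>u j. u < 2 ^ j \<and> nu2 u = Suc k \<and> \<psi> p = real u / 2 ^ j" if p: "p \<in> Field (omega_pow (Suc k))" for p
  proof -
    obtain x y where xy: "p = prod_encode (x, y)" "x \<in> Field ?W"
      using p unfolding omega_pow.simps Field_ord_mult[OF Well_order_omega_pow natLeq_Well_order] by blast
    obtain u j where u: "u < 2 ^ j" "nu2 u = k" "\<phi> x = real u / 2 ^ j" using \<phi>[OF xy(2)] by blast
    have "2 ^ j + u < 2 ^ (j + Suc y)"
    proof -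
      have "2 ^ j + u < 2 ^ Suc j" using u(1) by simp
      also have "\<dots> \<le> (2::nat) ^ (j + Suc y)" by (intro power_increasing) auto
      finally show ?thesis .
    qed
    moreover have "nu2 (2 ^ j + u) = Suc k" using nu2_pow_add[OF u(1)] u(2) by simp
    moreover have "\<psi> p = real (2 ^ j + u) / 2 ^ (j + Suc y)"
      by (simp add: \<psi>_def xy u power_add field_simps)
    ultimately show ?thesis by blast
  qed
  moreover have "\<psi> p' < \<psi> p" if pp: "(p, p') \<in> omega_pow (Suc k)" "p \<noteq> p'" for p p'
  proof -
    obtain x y x' y' where p: "p = prod_encode (x, y)" "p' = prod_encode (x', y')"
      and x: "x \<in> Field ?W" "x' \<in> Field ?W"
      and d: "y \<noteq> y' \<and> (y, y') \<in> natLeq \<or> y = y' \<and> (x, x') \<in> ?W"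
      using pp unfolding omega_pow.simps by (blast elim: ord_mult_cases)
    from d show ?thesis
    proof
      assume "y \<noteq> y' \<and> (y, y') \<in> natLeq"
      then have y: "Suc y \<le> y'" by (auto simp: natLeq_def)
      \<comment> \<open>Fractions with different leading positions are separated by a power of two,
        whatever their remainders.\<close>
      have "(1 + \<phi> x') / 2 ^ Suc y' < 2 / 2 ^ Suc y'"
        using range[OF x(2)] by (intro divide_strict_right_mono) auto
      also have "\<dots> = 1 / 2 ^ y'" by simp
      also have "\<dots> \<le> 1 / 2 ^ Suc y" using y by (intro divide_left_mono power_increasing) auto
      also have "\<dots> \<le> (1 + \<phi> x) / 2 ^ Suc y"
        using range[OF x(1)] by (intro divide_right_mono) auto
      finally show ?thesis by (simp add: \<psi>_def p)
    next
      assume d: "y = y' \<and> (x, x') \<in> ?W"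
      then have "\<phi> x' < \<phi> x" using dec pp(2) p by blast
      then show ?thesis using d by (simp add: \<psi>_def p divide_strict_right_mono)
    qed
  qed
  ultimately show ?case by blast
qed

text \<open>The excess \<open>?c m - m\<close> is a natural number that never increases under
  doubling; where it is least, every further doubling costs exactly one step.\<close>

lemma exists_stable:
  assumes A: "admissible A" and n: "1 \<le> n"
  shows "\<exists>m. stable A (2 ^ m * n)"
proof -
  let ?c = "\<lambda>m. chain_len A (2 ^ m * n)"
  have pos: "1 \<le> 2 ^ m * n" for m using n by simp
  have ge: "m \<le> ?c m" for m
  proof -
    have "2 ^ m \<le> 2 ^ m * n" using n by simp
    also have "\<dots> \<le> 2 ^ ?c m" by (rule le_pow_chain_len[OF A pos])
    finally show ?thesis by simp
  qed
  have le: "?c (m + k) \<le> ?c m + k" for m k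
  proof (induction k)
    case (Suc k)
    have "?c (m + Suc k) = chain_len A (2 * (2 ^ (m + k) * n))" by (simp add: mult.assoc)
    also have "\<dots> \<le> ?c (m + k) + 1" using A pos[of "m + k"] unfolding admissible_def by blast
    finally show ?case using Suc by simp
  qed simp
  obtain m where m: "\<And>k. ?c m - m \<le> ?c k - k"
    using ex_has_least_nat[of "\<lambda>_. True" 0 "\<lambda>k. ?c k - k"] by blast
  have "?c (m + k) = ?c m + k" for k
    using m[of "m + k"] le[of m k] ge[of m] ge[of "m + k"] by linarith
  then have "stable A (2 ^ m * n)" using pos[of m] unfolding stable_def
    by (simp add: power_add ac_simps)
  then show ?thesis ..
qed

text \<open>Passing to a stable multiple \<open>2 ^ m * n\<close> changes neither the fraction nor
  \<open>nu2\<close>. Colouring by the resulting \<open>s \<le> k\<close>, the pigeonhole lemma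
  yields a copy of \<open>\<omega>^k\<close> with constant \<open>s\<close>, on which defects
  increase as fractions decrease.\<close>

lemma strict_emb_stable_defects:
  assumes A: "admissible A"
  shows "\<exists>f. strict_emb (omega_pow k) (real_order_on (stable_defects A \<inter> {0..real k})) f"
proof -
  let ?W = "omega_pow k"
  obtain \<phi> :: "nat \<Rightarrow> real"
    where \<phi>: "\<And>x. x \<in> Field ?W \<Longrightarrow> \<exists>u j. u < 2 ^ j \<and> nu2 u = k \<and> \<phi> x = real u / 2 ^ j"
      and dec: "\<And>x y. (x, y) \<in> ?W \<Longrightarrow> x \<noteq> y \<Longrightarrow> \<phi> y < \<phi> x" using omega_pow_dyadic[of k] by blast
  have nonneg: "0 \<le> \<phi> x" if "x \<in> Field ?W" for x using \<phi>[OF that] by auto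
  have "\<exists>s\<in>{..k}. real s - log 2 (1 + \<phi> x) \<in> stable_defects A" if x: "x \<in> Field ?W" for x
  proof -
    obtain u j where u: "u < 2 ^ j" "nu2 u = k" "\<phi> x = real u / 2 ^ j" using \<phi>[OF x] by blast
    obtain m where m: "stable A (2 ^ m * (2 ^ j + u))"
      using exists_stable[OF A, of "2 ^ j + u"] by (auto simp: add_increasing2)
    have e: "2 ^ m * (2 ^ j + u) = 2 ^ (m + j) + 2 ^ m * u" by (simp add: power_add distrib_left)
    have lt: "2 ^ m * u < 2 ^ (m + j)" using u(1) by (simp add: power_add)
    obtain s where "s \<le> nu2 (2 ^ m * u)"
      "defect A (2 ^ (m + j) + 2 ^ m * u) = s - log 2 (1 + real (2 ^ m * u) / 2 ^ (m + j))"
      using chain_len_binary[OF A lt] .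
    then have "s \<le> k" "defect A (2 ^ m * (2 ^ j + u)) = s - log 2 (1 + \<phi> x)"
      unfolding e u by (simp_all add: power_add u)
    then show ?thesis using m unfolding stable_defects_def by (auto intro!: bexI[of _ s] exI[of _ "2 ^ m * (2 ^ j + u)"])
  qed
  then obtain c where c: "\<And>x. x \<in> Field ?W \<Longrightarrow> c x \<in> {..k}"
    and cd: "\<And>x. x \<in> Field ?W \<Longrightarrow> real (c x) - log 2 (1 + \<phi> x) \<in> stable_defects A" by metis
  obtain h i where i: "i \<in> {..k}" and h: "strict_emb ?W ?W h" and ch: "\<And>x. x \<in> Field ?W \<Longrightarrow> c (h x) = i"
    using omega_pow_pigeonhole[of "{..k}" k c] c by blast
  have hF: "h x \<in> Field ?W" if "x \<in> Field ?W" for x using h that unfolding strict_emb_def by blast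
  let ?f = "\<lambda>x. real i - log 2 (1 + \<phi> (h x))"
  have mem: "?f x \<in> stable_defects A \<inter> {0..real k}" if x: "x \<in> Field ?W" for x
  proof -
    have "?f x \<in> stable_defects A" using cd[OF hF[OF x]] ch[OF x] by simp
    moreover from this have "0 \<le> ?f x"
      using defect_nonneg[OF A] unfolding stable_defects_def stable_def mem_Collect_eq by metis
    moreover have "0 \<le> log 2 (1 + \<phi> (h x))" using nonneg[OF hF[OF x]] by simp
    ultimately show ?thesis using i by simp
  qed
  have "strict_emb ?W (real_order_on (stable_defects A \<inter> {0..real k})) ?f"
  proof (rule strict_embI)
    fix x assume "x \<in> Field ?W"
    then show "?f x \<in> Field (real_order_on (stable_defects A \<inter> {0..real k}))"
      unfolding Field_real_order_on by (rule mem)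
  next
    fix x y assume xy: "(x, y) \<in> ?W" "x \<noteq> y"
    then have F: "x \<in> Field ?W" "y \<in> Field ?W" by (auto intro: FieldI1 FieldI2)
    have "\<phi> (h y) < \<phi> (h x)" using dec h xy unfolding strict_emb_def by blast
    then have "?f x < ?f y" using nonneg[OF hF[OF F(2)]] by simp
    then show "(?f x, ?f y) \<in> real_order_on (stable_defects A \<inter> {0..real k}) \<and> ?f x \<noteq> ?f y"
      using mem[OF F(1)] mem[OF F(2)] by (auto simp: real_order_on_def)
  qed
  then show ?thesis by blast
qed

section \<open>Combining the two bounds\<close>

lemma strict_emb_real_mono:
  assumes "strict_emb r (real_order_on S) f" "S \<subseteq> T"
  shows "strict_emb r (real_order_on T) f"
  using assms unfolding strict_emb_def Field_real_order_on by (auto simp: real_order_on_def)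

lemma stable_defects_subset: "stable_defects A \<subseteq> defects A"
  unfolding stable_defects_def defects_def stable_def by blast

text \<open>\<open>S\<close> may be any set between the stable and all defects up to
  \<open>r\<close>: the lower bound comes from the smaller set, the upper bound from the larger, so
  both cases of the theorem follow at once.\<close>

lemma defects_order_type:
  assumes A: "admissible A" and r: "0 \<le> r"
    and S: "stable_defects A \<inter> {0..r} \<subseteq> S" "S \<subseteq> defects A \<inter> {0..r}"
  shows "well_order_on S (real_order_on S)" (is ?wo)
    and "omega_pow (nat \<lfloor>r\<rfloor>) \<le>o real_order_on S"
    and "real_order_on S \<le>o omega_sum (qmax A r)"
proof -
  obtain q where q: "qmax A r = Suc q" using qmax_pos[OF A r] .
  have "\<exists>n\<ge>1. nu2 n \<le> Suc q \<and> d = defect A n" if "d \<in> S" for d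
  proof -
    have "d \<in> defects A" "d \<le> r" using that S(2) by auto
    then obtain n where "n \<ge> 1" "d = defect A n" unfolding defects_def by blast
    then show ?thesis using nu2_le_qmax[OF A] \<open>d \<le> r\<close> q by metis
  qed
  then obtain f where f: "strict_emb (real_order_on S) (ord_mult (omega_pow q) (natLeq_on (Suc q))) f"
    using strict_emb_defects[OF A, of S q] S(2) by fastforce
  have f': "strict_emb (real_order_on S) (omega_sum (Suc q)) ((\<lambda>x. sum_encode (Inl x)) \<circ> f)"
    by (rule strict_emb_comp[OF f strict_emb_omega_sum])
  show wo: ?wo by (rule well_order_on_real_order_on[OF Well_order_omega_sum f'])
  then have W: "Well_order (real_order_on S)" by simp
  show "real_order_on S \<le>o omega_sum (qmax A r)"
    unfolding q by (rule strict_emb_ordLeq[OF W Well_order_omega_sum f'])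
  obtain g where g: "strict_emb (omega_pow (nat \<lfloor>r\<rfloor>)) (real_order_on (stable_defects A \<inter> {0..real (nat \<lfloor>r\<rfloor>)})) g"
    using strict_emb_stable_defects[OF A] by blast
  have "real (nat \<lfloor>r\<rfloor>) \<le> r" using r by linarith
  then have "stable_defects A \<inter> {0..real (nat \<lfloor>r\<rfloor>)} \<subseteq> S"
    using S(1) by (force simp del: of_nat_nat)
  from strict_emb_ordLeq[OF Well_order_omega_pow W strict_emb_real_mono[OF g this]]
  show "omega_pow (nat \<lfloor>r\<rfloor>) \<le>o real_order_on S" .
qed

theorem theorem6p4:
  fixes A :: "nat list set" and r :: real
  assumes "admissible A" and "0 \<le> r"
  shows "(\<forall>S \<in> {defects A \<inter> {0..r}, stable_defects A \<inter> {0..r}}.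
            well_order_on S (real_order_on S) \<and>
            omega_pow (nat \<lfloor>r\<rfloor>) \<le>o real_order_on S \<and>
            real_order_on S \<le>o omega_sum (qmax A r)) \<and>
         omega_sum (qmax A r) <o
           ord_mult (omega_pow (qmax A r - 1)) (natLeq_on (qmax A r + 1)) \<and>
         omega_sum (qmax A r) <o omega_pow (qmax A r)"
proof (intro conjI ballI)
  fix S assume "S \<in> {defects A \<inter> {0..r}, stable_defects A \<inter> {0..r}}"
  then have "stable_defects A \<inter> {0..r} \<subseteq> S" "S \<subseteq> defects A \<inter> {0..r}"
    using stable_defects_subset by blast+
  note S = defects_order_type[OF assms this]
  show "well_order_on S (real_order_on S)" by (rule S)
  show "omega_pow (nat \<lfloor>r\<rfloor>) \<le>o real_order_on S" by (rule S)
  show "real_order_on S \<le>o omega_sum (qmax A r)" by (rule S)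
next
  obtain q where q: "qmax A r = Suc q" using qmax_pos[OF assms] .
  show "omega_sum (qmax A r) <o ord_mult (omega_pow (qmax A r - 1)) (natLeq_on (qmax A r + 1))"
    using omega_sum_less_mult[of q] unfolding q by simp
  show "omega_sum (qmax A r) <o omega_pow (qmax A r)"
    by (rule omega_sum_less_pow)
qed

end
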